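(* Let $\Gamma$ be a finitely generated group acting by isometries on a metric space $X$ with a base point $x_0$ and with $\operatorname{asdim}X\le k$. Suppose that $\operatorname{asdim}W_R(x_0)\le n$ for all $R>0$. Then $\operatorname{asdim}\Gamma\le (n+1)(k+1)-1$.
   Context: Two sets $U_1,U_2$ in a metric space are $d$-disjoint if $\inf\{\operatorname{dist}(x_1,x_2)\mid x_1\in U_1,\ x_2\in U_2\}\ge d$; a family of sets is $d$-disjoint if any two distinct members are. A metric space $X$ satisfies $\operatorname{asdim}X\le n$ if for every (arbitrarily large) $d>0$ there are $n+1$ uniformly bounded $d$-disjoint families of subsets of $X$ whose union covers $X$ (uniformly bounded: diameters bounded by a common constant). A finitely generated group $\Gamma$ carries the left-invariant word metric $d_S(x,y)$ = the word length of $x^{-1}y$ with respect to a finite generating set $S$; $\operatorname{asdim}\Gamma$ means $\operatorname{asdim}(\Gamma,d_S)$, which does not depend on $S$. Subsets of $\Gamma$ carry the restricted metric. For $R>0$, the $R$-stabilizer of $x_0\in X$ is $W_R(x_0)=\{g\in\Gamma\mid g(x_0)\in B_R(x_0)\}$, where $B_R(x_0)$ is the closed ball of radius $R$ centered at $x_0$. *)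

theory Defs
  imports
    "HOL-Analysis.Abstract_Metric_Spaces"
    "HOL-Library.Extended_Real"
    "HOL-Algebra.Generated_Groups"
    "HOL-Algebra.Group_Action"
begin

section \<open>Asymptotic dimension\<close>

text \<open>Distances between sets and diameters take values in \<^typ>\<open>ereal\<close>, so that an infimum over the
  empty set is infinite (the empty set is disjoint from everything at any scale) and an unbounded
  set has infinite diameter.\<close>

definition set_distance :: "('a \<Rightarrow> 'a \<Rightarrow> real) \<Rightarrow> 'a set \<Rightarrow> 'a set \<Rightarrow> ereal" where
  "set_distance d U V = (INF x\<in>U. INF y\<in>V. ereal (d x y))"

definition set_diameter :: "('a \<Rightarrow> 'a \<Rightarrow> real) \<Rightarrow> 'a set \<Rightarrow> ereal" where
  "set_diameter d U = (SUP x\<in>U. SUP y\<in>U. ereal (d x y))"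

definition disjoint_family_at :: "('a \<Rightarrow> 'a \<Rightarrow> real) \<Rightarrow> real \<Rightarrow> 'a set set \<Rightarrow> bool" where
  "disjoint_family_at d r \<F> \<longleftrightarrow> (\<forall>U\<in>\<F>. \<forall>V\<in>\<F>. U \<noteq> V \<longrightarrow> set_distance d U V \<ge> ereal r)"

definition uniformly_bounded_family :: "('a \<Rightarrow> 'a \<Rightarrow> real) \<Rightarrow> 'a set set \<Rightarrow> bool" where
  "uniformly_bounded_family d \<F> \<longleftrightarrow> (\<exists>B::real. \<forall>U\<in>\<F>. set_diameter d U \<le> ereal B)"

text \<open>A subset \<open>A\<close> of a metric space \<open>(M, d)\<close> with the restricted metric is \<open>asdim_le A d n\<close>.\<close>

definition asdim_le :: "'a set \<Rightarrow> ('a \<Rightarrow> 'a \<Rightarrow> real) \<Rightarrow> nat \<Rightarrow> bool" where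
  "asdim_le M d n \<longleftrightarrow>
    (\<forall>r>0. \<exists>\<F> :: nat \<Rightarrow> 'a set set.
        (\<forall>i\<le>n. \<F> i \<subseteq> Pow M \<and> uniformly_bounded_family d (\<F> i) \<and> disjoint_family_at d r (\<F> i)) \<and>
        M \<subseteq> (\<Union>i\<le>n. \<Union>(\<F> i)))"

lemma set_distance_ge_iff:
  "set_distance d U V \<ge> ereal r \<longleftrightarrow> (\<forall>x\<in>U. \<forall>y\<in>V. d x y \<ge> r)"
  by (simp add: set_distance_def le_INF_iff)

lemma set_diameter_le_iff:
  "set_diameter d U \<le> ereal B \<longleftrightarrow> (\<forall>x\<in>U. \<forall>y\<in>U. d x y \<le> B)"
  by (simp add: set_diameter_def SUP_le_iff)


section \<open>Word metrics\<close>

definition finite_generating_set :: "('a, 'b) monoid_scheme \<Rightarrow> 'a set \<Rightarrow> bool" where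
  "finite_generating_set G S \<longleftrightarrow> finite S \<and> S \<subseteq> carrier G \<and> generate G S = carrier G"

definition word_for :: "('a, 'b) monoid_scheme \<Rightarrow> 'a set \<Rightarrow> 'a list \<Rightarrow> 'a \<Rightarrow> bool" where
  "word_for G S ws g \<longleftrightarrow>
    set ws \<subseteq> S \<union> m_inv G ` S \<and> foldr (\<otimes>\<^bsub>G\<^esub>) ws \<one>\<^bsub>G\<^esub> = g"

definition word_length :: "('a, 'b) monoid_scheme \<Rightarrow> 'a set \<Rightarrow> 'a \<Rightarrow> nat" where
  "word_length G S g = (LEAST l. \<exists>ws. length ws = l \<and> word_for G S ws g)"

text \<open>The value \<open>0\<close> off the carrier is a convention only: \<^locale>\<open>Metric_space\<close> demands symmetry on the
  whole type.\<close>

definition word_metric :: "('a, 'b) monoid_scheme \<Rightarrow> 'a set \<Rightarrow> 'a \<Rightarrow> 'a \<Rightarrow> real" where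
  "word_metric G S x y =
    (if x \<in> carrier G \<and> y \<in> carrier G then real (word_length G S (inv\<^bsub>G\<^esub> x \<otimes>\<^bsub>G\<^esub> y)) else 0)"

context group
begin

lemma word_for_closed:
  assumes "S \<subseteq> carrier G" "word_for G S ws g"
  shows "set ws \<subseteq> carrier G" "g \<in> carrier G"
proof -
  show 1: "set ws \<subseteq> carrier G"
    using assms by (auto simp: word_for_def)
  have "foldr (\<otimes>) ws \<one> \<in> carrier G"
    using 1 by (induction ws) auto
  then show "g \<in> carrier G"
    using assms by (simp add: word_for_def)
qed

lemma word_for_append:
  assumes S: "S \<subseteq> carrier G" and "word_for G S us g" "word_for G S vs h"
  shows "word_for G S (us @ vs) (g \<otimes> h)"
proof -
  have h: "h \<in> carrier G"
    using word_for_closed assms by blast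
  have "foldr (\<otimes>) us h = foldr (\<otimes>) us \<one> \<otimes> h \<and> foldr (\<otimes>) us \<one> \<in> carrier G"
    if "set us \<subseteq> carrier G" for us
    using that h by (induction us) (auto simp: m_assoc)
  then have "foldr (\<otimes>) us h = foldr (\<otimes>) us \<one> \<otimes> h"
    using word_for_closed(1)[OF S assms(2)] by blast
  then show ?thesis
    using assms by (simp add: word_for_def)
qed

lemma word_for_inv:
  assumes S: "S \<subseteq> carrier G" and "word_for G S ws g"
  shows "\<exists>vs. length vs = length ws \<and> word_for G S vs (inv g)"
  using assms(2)
proof (induction ws arbitrary: g)
  case Nil
  then show ?case by (auto simp: word_for_def)
next
  case (Cons a ws)
  define h where "h = foldr (\<otimes>) ws \<one>"
  have h: "word_for G S ws h" and g: "g = a \<otimes> h" and a: "a \<in> S \<union> m_inv G ` S"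
    using Cons.prems by (auto simp: word_for_def h_def)
  obtain vs where vs: "length vs = length ws" "word_for G S vs (inv h)"
    using Cons.IH[OF h] by blast
  have ac: "a \<in> carrier G" and hc: "h \<in> carrier G"
    using a S word_for_closed[OF S h] by auto
  have "inv a \<in> S \<union> m_inv G ` S"
    using a S by auto
  then have "word_for G S [inv a] (inv a)"
    using ac by (auto simp: word_for_def)
  from word_for_append[OF S vs(2) this] have "word_for G S (vs @ [inv a]) (inv g)"
    using ac hc by (simp add: g inv_mult_group)
  then show ?case
    using vs(1) by (intro exI[of _ "vs @ [inv a]"]) simp
qed

lemma word_for_exists:
  assumes S: "S \<subseteq> carrier G" and "g \<in> generate G S"
  shows "\<exists>ws. word_for G S ws g"
  using assms(2)
proof (induction rule: generate.induct)
  case one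
  then show ?case by (intro exI[of _ "[]"]) (simp add: word_for_def)
next
  case (incl h)
  then show ?case using S by (intro exI[of _ "[h]"]) (auto simp: word_for_def)
next
  case (inv h)
  then show ?case using S by (intro exI[of _ "[inv h]"]) (auto simp: word_for_def)
next
  case (eng h1 h2)
  then show ?case using word_for_append[OF S] by blast
qed

lemma word_length_le: "word_for G S ws g \<Longrightarrow> word_length G S g \<le> length ws"
  unfolding word_length_def by (rule Least_le) blast

lemma word_length_attained:
  assumes "finite_generating_set G S" "g \<in> carrier G"
  obtains ws where "length ws = word_length G S g" "word_for G S ws g"
proof -
  have "\<exists>ws. word_for G S ws g"
    using word_for_exists assms unfolding finite_generating_set_def by blast
  then have "\<exists>l ws. length ws = l \<and> word_for G S ws g" by blast
  from LeastI_ex[OF this] show ?thesis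
    using that unfolding word_length_def by blast
qed

lemma word_length_inv_le:
  assumes "finite_generating_set G S" "g \<in> carrier G"
  shows "word_length G S (inv g) \<le> word_length G S g"
proof -
  obtain ws where ws: "length ws = word_length G S g" "word_for G S ws g"
    using word_length_attained[OF assms] .
  then obtain vs where "length vs = length ws" "word_for G S vs (inv g)"
    using word_for_inv assms(1) unfolding finite_generating_set_def by blast
  then show ?thesis using word_length_le ws(1) by metis
qed

lemma Metric_space_word_metric:
  assumes "finite_generating_set G S"
  shows "Metric_space (carrier G) (word_metric G S)"
proof
  have S: "S \<subseteq> carrier G"
    using assms by (simp add: finite_generating_set_def)
  show "0 \<le> word_metric G S x y" for x y
    by (simp add: word_metric_def)
  have le: "word_metric G S x y \<le> word_metric G S y x"
    if "x \<in> carrier G" "y \<in> carrier G" for x y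
    using word_length_inv_le[OF assms, of "inv y \<otimes> x"] that
    by (simp add: word_metric_def inv_mult_group)
  show "word_metric G S x y = word_metric G S y x" for x y
  proof (cases "x \<in> carrier G \<and> y \<in> carrier G")
    case True
    then show ?thesis using le[of x y] le[of y x] by simp
  qed (auto simp: word_metric_def)
  show "word_metric G S x y = 0 \<longleftrightarrow> x = y"
    if xy: "x \<in> carrier G" "y \<in> carrier G" for x y
  proof
    assume "word_metric G S x y = 0"
    then have 0: "word_length G S (inv x \<otimes> y) = 0"
      using xy by (simp add: word_metric_def)
    have "inv x \<otimes> y \<in> carrier G" using xy by simp
    then obtain ws where "length ws = word_length G S (inv x \<otimes> y)" "word_for G S ws (inv x \<otimes> y)"
      using word_length_attained[OF assms] by blast
    then have "inv x \<otimes> y = \<one>"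
      using 0 by (simp add: word_for_def)
    then show "x = y"
      using xy inv_solve_left'[of \<one> x y] by simp
  next
    assume "x = y"
    moreover have "word_length G S \<one> \<le> length ([] :: 'a list)"
      by (rule word_length_le) (simp add: word_for_def)
    ultimately show "word_metric G S x y = 0"
      using xy by (simp add: word_metric_def)
  qed
  show "word_metric G S x z \<le> word_metric G S x y + word_metric G S y z"
    if xyz: "x \<in> carrier G" "y \<in> carrier G" "z \<in> carrier G" for x y z
  proof -
    have c: "inv x \<otimes> y \<in> carrier G" "inv y \<otimes> z \<in> carrier G"
      using xyz by auto
    obtain us where us: "length us = word_length G S (inv x \<otimes> y)" "word_for G S us (inv x \<otimes> y)"
      using word_length_attained[OF assms c(1)] .
    obtain vs where vs: "length vs = word_length G S (inv y \<otimes> z)" "word_for G S vs (inv y \<otimes> z)"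
      using word_length_attained[OF assms c(2)] .
    have "y \<otimes> (inv y \<otimes> z) = z"
      using xyz by (simp add: m_assoc [symmetric])
    then have "(inv x \<otimes> y) \<otimes> (inv y \<otimes> z) = inv x \<otimes> z"
      using xyz by (simp add: m_assoc)
    then have "word_for G S (us @ vs) (inv x \<otimes> z)"
      using word_for_append[OF S us(2) vs(2)] by simp
    from word_length_le[OF this] show ?thesis
      using us(1) vs(1) xyz by (simp add: word_metric_def)
  qed
qed

end


section \<open>Isometric actions\<close>

text \<open>As everywhere in \<^theory>\<open>HOL-Algebra.Group_Action\<close>, \<open>\<phi> g\<close> is the bijection of \<open>X\<close> by which \<open>g\<close>
  acts.\<close>

locale isometric_action = group_action G X \<phi> + Metric_space X d
  for G (structure) and X and \<phi> and d +
  assumes isometry: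
    "\<lbrakk>g \<in> carrier G; x \<in> X; y \<in> X\<rbrakk> \<Longrightarrow> d (\<phi> g x) (\<phi> g y) = d x y"

definition (in isometric_action) coarse_stabilizer :: "real \<Rightarrow> 'c \<Rightarrow> 'a set" where
  "coarse_stabilizer R x = {g \<in> carrier G. \<phi> g x \<in> mcball x R}"

end

theory Submission
  imports Defs
begin

text \<open>The orbit map \<open>g \<mapsto> \<phi> g x\<^sub>0\<close> from the group to \<open>X\<close> is Lipschitz, because the group is finitely
  generated, and the part of the group lying over a set of diameter at most \<open>R\<close> is, after a left
  translation, contained in the \<open>R\<close>-stabilizer. Left translations are isometries of the word metric,
  so all these parts are covered by \<open>n + 1\<close> families with the same bound
  (\<open>uniform_asdim_le_isometric\<close>). A cover of \<open>X\<close> by \<open>k + 1\<close> families then pulls back to the group: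
  members of one family over distinct sets are far apart by the Lipschitz property, and each
  preimage is split further into \<open>n + 1\<close> families. One new family for each pair of an old family in
  \<open>X\<close> and a family in the preimages gives \<open>(n + 1) * (k + 1)\<close> of them
  (\<open>asdim_le_of_lipschitz_fibres\<close>).\<close>

section \<open>Uniform asymptotic dimension of a collection of sets\<close>

definition asdim_cover ::
  "('a \<Rightarrow> 'a \<Rightarrow> real) \<Rightarrow> nat \<Rightarrow> real \<Rightarrow> real \<Rightarrow> 'a set \<Rightarrow> (nat \<Rightarrow> 'a set set) \<Rightarrow> bool" where
  "asdim_cover d n r B A \<F> \<longleftrightarrow>
    (\<forall>i\<le>n. \<F> i \<subseteq> Pow A \<and> (\<forall>V\<in>\<F> i. set_diameter d V \<le> ereal B) \<and>
           disjoint_family_at d r (\<F> i)) \<and>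
    A \<subseteq> (\<Union>i\<le>n. \<Union>(\<F> i))"

text \<open>The diameter bound is chosen before the member of the collection: this uniformity is what
  keeps the union of the covers of infinitely many sets uniformly bounded.\<close>

definition uniform_asdim_le :: "'a set set \<Rightarrow> ('a \<Rightarrow> 'a \<Rightarrow> real) \<Rightarrow> nat \<Rightarrow> bool" where
  "uniform_asdim_le \<A> d n \<longleftrightarrow> (\<forall>r>0. \<exists>B. \<forall>A\<in>\<A>. \<exists>\<F>. asdim_cover d n r B A \<F>)"

text \<open>A single cover of \<open>W\<close>, pulled back along the isometric embeddings, serves all members of the
  collection with its own bound.\<close>

lemma uniform_asdim_le_isometric:
  assumes W: "asdim_le W d n"
    and emb: "\<And>A. A \<in> \<A> \<Longrightarrow> \<exists>t. t ` A \<subseteq> W \<and> (\<forall>a\<in>A. \<forall>b\<in>A. d (t a) (t b) = d a b)"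
  shows "uniform_asdim_le \<A> d n"
  unfolding uniform_asdim_le_def
proof (intro allI impI)
  fix r :: real assume "r > 0"
  then obtain \<E> where \<E>: "\<And>i. i \<le> n \<Longrightarrow> uniformly_bounded_family d (\<E> i)"
      "\<And>i. i \<le> n \<Longrightarrow> disjoint_family_at d r (\<E> i)" and cov: "W \<subseteq> (\<Union>i\<le>n. \<Union>(\<E> i))"
    using W unfolding asdim_le_def by metis
  obtain b where b: "\<And>i V. \<lbrakk>i \<le> n; V \<in> \<E> i\<rbrakk> \<Longrightarrow> set_diameter d V \<le> ereal (b i)"
    using \<E>(1) unfolding uniformly_bounded_family_def by metis
  define B where "B = Max (b ` {..n})"
  have bB: "b i \<le> B" if "i \<le> n" for i
    using that by (simp add: B_def)
  have B: "d x y \<le> B" if "i \<le> n" "V \<in> \<E> i" "x \<in> V" "y \<in> V" for i V x y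
    using b[OF that(1,2)] bB[OF that(1)] that(3,4) by (force simp: set_diameter_le_iff)
  show "\<exists>B. \<forall>A\<in>\<A>. \<exists>\<F>. asdim_cover d n r B A \<F>"
  proof (intro exI[of _ B] ballI)
    fix A assume "A \<in> \<A>"
    then obtain t where t: "t ` A \<subseteq> W" "\<And>a b. \<lbrakk>a \<in> A; b \<in> A\<rbrakk> \<Longrightarrow> d (t a) (t b) = d a b"
      using emb by metis
    define \<F> where "\<F> i = (\<lambda>V. A \<inter> t -` V) ` \<E> i" for i
    have "\<F> i \<subseteq> Pow A" for i
      by (auto simp: \<F>_def)
    moreover have "set_diameter d U \<le> ereal B" if "i \<le> n" "U \<in> \<F> i" for i U
      using that B t(2) by (fastforce simp: \<F>_def set_diameter_le_iff)
    moreover have "disjoint_family_at d r (\<F> i)" if "i \<le> n" for i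
      unfolding disjoint_family_at_def set_distance_ge_iff
    proof (intro ballI impI)
      fix U U' x y assume U: "U \<in> \<F> i" "U' \<in> \<F> i" "U \<noteq> U'" "x \<in> U" "y \<in> U'"
      then obtain V V' where V: "V \<in> \<E> i" "V' \<in> \<E> i" "V \<noteq> V'"
          "x \<in> A" "y \<in> A" "t x \<in> V" "t y \<in> V'"
        by (auto simp: \<F>_def)
      then have "r \<le> d (t x) (t y)"
        using \<E>(2)[OF \<open>i \<le> n\<close>] unfolding disjoint_family_at_def set_distance_ge_iff by blast
      then show "r \<le> d x y"
        using t(2) V by simp
    qed
    moreover have "A \<subseteq> (\<Union>i\<le>n. \<Union>(\<F> i))"
      using t(1) cov by (fastforce simp: \<F>_def)
    ultimately show "\<exists>\<F>. asdim_cover d n r B A \<F>"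
      unfolding asdim_cover_def by (intro exI[of _ \<F>]) simp
  qed
qed

section \<open>Asymptotic dimension from a Lipschitz map and its fibres\<close>

text \<open>A product form of Hurewicz's dimension theorem. Over each member \<open>U\<close> of a
  cover of the base the preimage has its own cover by \<open>n + 1\<close> families; collecting, for a fixed
  family of the base and a fixed index \<open>j\<close>, the \<open>j\<close>-th families over all its members preserves
  disjointness, since preimages of far apart sets are far apart.\<close>

lemma asdim_le_of_lipschitz_fibres:
  fixes d :: "'a \<Rightarrow> 'a \<Rightarrow> real" and d' :: "'b \<Rightarrow> 'b \<Rightarrow> real"
  assumes f: "f ` M \<subseteq> X"
    and L: "L > 0" "\<And>a b. \<lbrakk>a \<in> M; b \<in> M\<rbrakk> \<Longrightarrow> d' (f a) (f b) \<le> L * d a b"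
    and X: "asdim_le X d' k"
    and fib: "\<And>R. uniform_asdim_le {M \<inter> f -` U | U. U \<subseteq> X \<and> set_diameter d' U \<le> ereal R} d n"
  shows "asdim_le M d ((n + 1) * (k + 1) - 1)"
  unfolding asdim_le_def
proof (intro allI impI)
  fix r :: real assume r: "r > 0"
  \<comment> \<open>The scale \<open>L * r\<close> in the base forces the scale \<open>r\<close> upstairs.\<close>
  have "L * r > 0" using L r by simp
  then obtain \<E> where \<E>: "\<And>i. i \<le> k \<Longrightarrow> \<E> i \<subseteq> Pow X"
      "\<And>i. i \<le> k \<Longrightarrow> uniformly_bounded_family d' (\<E> i)"
      "\<And>i. i \<le> k \<Longrightarrow> disjoint_family_at d' (L * r) (\<E> i)" and cov: "X \<subseteq> (\<Union>i\<le>k. \<Union>(\<E> i))"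
    using X unfolding asdim_le_def by metis
  obtain R where R: "\<And>i U. \<lbrakk>i \<le> k; U \<in> \<E> i\<rbrakk> \<Longrightarrow> set_diameter d' U \<le> ereal (R i)"
    using \<E>(2) unfolding uniformly_bounded_family_def by metis
  define P where "P \<rho> = {M \<inter> f -` U | U. U \<subseteq> X \<and> set_diameter d' U \<le> ereal \<rho>}" for \<rho>
  have "\<exists>b. \<forall>A\<in>P (R i). \<exists>\<F>. asdim_cover d n r b A \<F>" for i
    using fib[of "R i"] r by (simp only: P_def uniform_asdim_le_def)
  then obtain B where B: "\<And>i A. A \<in> P (R i) \<Longrightarrow> \<exists>\<F>. asdim_cover d n r (B i) A \<F>"
    by metis
  have "M \<inter> f -` U \<in> P (R i)" if "i \<le> k" "U \<in> \<E> i" for i U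
    using R[OF that] \<E>(1)[OF that(1)] that(2) unfolding P_def by blast
  then have "\<exists>\<F>. asdim_cover d n r (B i) (M \<inter> f -` U) \<F>" if "i \<le> k" "U \<in> \<E> i" for i U
    using B that by blast
  then obtain \<F> where
    "\<And>i U. \<lbrakk>i \<le> k; U \<in> \<E> i\<rbrakk> \<Longrightarrow> asdim_cover d n r (B i) (M \<inter> f -` U) (\<F> i U)"
    by metis
  then have \<F>:
      "\<And>i U j. \<lbrakk>i \<le> k; U \<in> \<E> i; j \<le> n\<rbrakk> \<Longrightarrow> \<F> i U j \<subseteq> Pow (M \<inter> f -` U)"
      "\<And>i U j V. \<lbrakk>i \<le> k; U \<in> \<E> i; j \<le> n; V \<in> \<F> i U j\<rbrakk> \<Longrightarrow> set_diameter d V \<le> ereal (B i)"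
      "\<And>i U j. \<lbrakk>i \<le> k; U \<in> \<E> i; j \<le> n\<rbrakk> \<Longrightarrow> disjoint_family_at d r (\<F> i U j)"
      "\<And>i U. \<lbrakk>i \<le> k; U \<in> \<E> i\<rbrakk> \<Longrightarrow> M \<inter> f -` U \<subseteq> (\<Union>j\<le>n. \<Union>(\<F> i U j))"
    unfolding asdim_cover_def by simp_all
  define \<G> where "\<G> i j = (\<Union>U\<in>\<E> i. \<F> i U j)" for i j
  have sub: "\<G> i j \<subseteq> Pow M" if "i \<le> k" "j \<le> n" for i j
    using \<F>(1) that by (fastforce simp: \<G>_def)
  have bdd: "uniformly_bounded_family d (\<G> i j)" if "i \<le> k" "j \<le> n" for i j
    using \<F>(2) that unfolding uniformly_bounded_family_def \<G>_def by blast
  have disj: "disjoint_family_at d r (\<G> i j)" if ij: "i \<le> k" "j \<le> n" for i j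
    unfolding disjoint_family_at_def set_distance_ge_iff
  proof (intro ballI impI)
    fix V V' x y assume V: "V \<in> \<G> i j" "V' \<in> \<G> i j" "V \<noteq> V'" "x \<in> V" "y \<in> V'"
    then obtain U U' where U: "U \<in> \<E> i" "V \<in> \<F> i U j" "U' \<in> \<E> i" "V' \<in> \<F> i U' j"
      by (auto simp: \<G>_def)
    show "r \<le> d x y"
    proof (cases "U = U'")
      case True
      then show ?thesis
        using \<F>(3)[OF ij(1) U(1) ij(2)] U V
        unfolding disjoint_family_at_def set_distance_ge_iff by blast
    next
      case False
      have xy: "x \<in> M" "f x \<in> U" "y \<in> M" "f y \<in> U'"
        using \<F>(1)[OF ij(1) _ ij(2)] U V by blast+
      have "L * r \<le> d' (f x) (f y)"
        using \<E>(3)[OF ij(1)] U False xy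
        unfolding disjoint_family_at_def set_distance_ge_iff by blast
      also have "\<dots> \<le> L * d x y"
        using L xy by simp
      finally show ?thesis using L by simp
    qed
  qed
  have covM: "\<exists>i\<le>k. \<exists>j\<le>n. x \<in> \<Union>(\<G> i j)" if "x \<in> M" for x
  proof -
    obtain i U where i: "i \<le> k" "U \<in> \<E> i" "f x \<in> U"
      using cov f \<open>x \<in> M\<close> by blast
    then obtain j where "j \<le> n" "x \<in> \<Union>(\<F> i U j)"
      using \<F>(4)[OF i(1,2)] \<open>x \<in> M\<close> by blast
    then show ?thesis using i by (auto simp: \<G>_def)
  qed
  \<comment> \<open>The pair \<open>(i, j)\<close> is encoded as the single index \<open>i * (n + 1) + j\<close>.\<close>
  define \<H> where "\<H> l = \<G> (l div (n + 1)) (l mod (n + 1))" for l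
  have idx: "l div (n + 1) \<le> k" "l mod (n + 1) \<le> n" if "l \<le> (n + 1) * (k + 1) - 1" for l
  proof -
    have "l < (k + 1) * (n + 1)"
      using that by (simp add: mult.commute)
    then show "l div (n + 1) \<le> k"
      using less_mult_imp_div_less[of l "k + 1" "n + 1"] by simp
    show "l mod (n + 1) \<le> n"
      using mod_less_divisor[of "n + 1" l] by simp
  qed
  have "M \<subseteq> (\<Union>l\<le>(n + 1) * (k + 1) - 1. \<Union>(\<H> l))"
  proof
    fix x assume "x \<in> M"
    then obtain i j where ij: "i \<le> k" "j \<le> n" "x \<in> \<Union>(\<G> i j)"
      using covM by blast
    define l where "l = i * (n + 1) + j"
    have "(l div (n + 1)) = i" "l mod (n + 1) = j"
      using ij(2) div_mult_self3[of "n + 1" i j] by (simp_all add: l_def del: mult_Suc_right)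
    then have "x \<in> \<Union>(\<H> l)"
      using ij(3) by (simp add: \<H>_def)
    moreover have "l \<le> k * (n + 1) + n"
      unfolding l_def by (intro add_mono mult_right_mono ij) simp
    then have "l \<le> (n + 1) * (k + 1) - 1"
      by (simp add: algebra_simps)
    ultimately show "x \<in> (\<Union>l\<le>(n + 1) * (k + 1) - 1. \<Union>(\<H> l))"
      by blast
  qed
  then show "\<exists>\<F>. (\<forall>l\<le>(n + 1) * (k + 1) - 1. \<F> l \<subseteq> Pow M \<and> uniformly_bounded_family d (\<F> l) \<and>
        disjoint_family_at d r (\<F> l)) \<and> M \<subseteq> (\<Union>l\<le>(n + 1) * (k + 1) - 1. \<Union>(\<F> l))"
    using sub bdd disj idx by (intro exI[of _ \<H>]) (simp add: \<H>_def)
qed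

section \<open>The orbit map of an isometric action\<close>

lemma (in group) word_metric_left_invariant:
  assumes "g \<in> carrier G" "a \<in> carrier G" "b \<in> carrier G"
  shows "word_metric G S (g \<otimes> a) (g \<otimes> b) = word_metric G S a b"
proof -
  have "inv g \<otimes> (g \<otimes> b) = b"
    using assms by (simp add: m_assoc [symmetric])
  then have "inv (g \<otimes> a) \<otimes> (g \<otimes> b) = inv a \<otimes> b"
    using assms by (simp add: inv_mult_group m_assoc)
  then show ?thesis
    using assms by (simp add: word_metric_def)
qed

context isometric_action
begin

interpretation G: group G
  using group_hom by (rule group_hom.axioms)

lemma act_closed: "\<lbrakk>g \<in> carrier G; x \<in> X\<rbrakk> \<Longrightarrow> \<phi> g x \<in> X"
  using element_image by blast

text \<open>By isometry, distances in the orbit depend only on the quotient \<open>inv g \<otimes> h\<close>, exactly as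
  in the word metric. It links the orbit map both to the word length and to the coarse
  stabilizers.\<close>

lemma dist_orbit:
  assumes "g \<in> carrier G" "h \<in> carrier G" "x \<in> X"
  shows "d (\<phi> g x) (\<phi> h x) = d x (\<phi> (inv g \<otimes> h) x)"
proof -
  have "g \<otimes> (inv g \<otimes> h) = h"
    using assms by (simp add: G.m_assoc [symmetric])
  then have "\<phi> h x = \<phi> g (\<phi> (inv g \<otimes> h) x)"
    using assms composition_rule[of x g "inv g \<otimes> h"] by simp
  then show ?thesis
    using assms isometry[of g x "\<phi> (inv g \<otimes> h) x"] by (simp add: act_closed)
qed

lemma dist_orbit_word_le:
  assumes S: "S \<subseteq> carrier G" and x: "x \<in> X"
    and L: "\<And>s. s \<in> S \<union> m_inv G ` S \<Longrightarrow> d x (\<phi> s x) \<le> L"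
    and "word_for G S ws g"
  shows "d x (\<phi> g x) \<le> L * length ws"
  using assms(4)
proof (induction ws arbitrary: g)
  case Nil
  then show ?case
    using x id_eq_one by (auto simp: word_for_def dest: fun_cong[of _ _ x])
next
  case (Cons a ws)
  define h where "h = foldr (\<otimes>) ws \<one>"
  have h: "word_for G S ws h" and g: "g = a \<otimes> h" and a: "a \<in> S \<union> m_inv G ` S"
    using Cons.prems by (auto simp: word_for_def h_def)
  have ac: "a \<in> carrier G" and hc: "h \<in> carrier G"
    using a S G.word_for_closed[OF S h] by auto
  have "d x (\<phi> g x) \<le> d x (\<phi> a x) + d (\<phi> a x) (\<phi> g x)"
    using ac hc x by (intro triangle) (simp_all add: act_closed g)
  also have "d (\<phi> a x) (\<phi> g x) = d x (\<phi> h x)"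
    using ac hc x composition_rule[of x a h] isometry[of a x "\<phi> h x"] by (simp add: g act_closed)
  also have "d x (\<phi> a x) + d x (\<phi> h x) \<le> L + L * length ws"
    using L[OF a] Cons.IH[OF h] by simp
  finally show ?case by (simp add: algebra_simps)
qed

text \<open>The farthest any generator moves the base point is a Lipschitz constant.\<close>

lemma orbit_map_lipschitz:
  assumes gen: "finite_generating_set G S" and x: "x \<in> X"
  obtains L where "L > 0"
    "\<And>g h. \<lbrakk>g \<in> carrier G; h \<in> carrier G\<rbrakk> \<Longrightarrow> d (\<phi> g x) (\<phi> h x) \<le> L * word_metric G S g h"
proof -
  have S: "finite S" "S \<subseteq> carrier G"
    using gen by (auto simp: finite_generating_set_def)
  \<comment> \<open>Including \<open>1\<close> keeps the constant positive when every generator fixes the base point.\<close>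
  define L where "L = Max (insert 1 ((\<lambda>s. d x (\<phi> s x)) ` (S \<union> m_inv G ` S)))"
  have "L \<ge> 1" and le: "\<And>s. s \<in> S \<union> m_inv G ` S \<Longrightarrow> d x (\<phi> s x) \<le> L"
    using S(1) by (auto simp: L_def intro!: Max_ge)
  show thesis
  proof (rule that)
    show "L > 0" using \<open>L \<ge> 1\<close> by simp
    fix g h assume gh: "g \<in> carrier G" "h \<in> carrier G"
    then have "inv g \<otimes> h \<in> carrier G" by simp
    then obtain ws where ws: "length ws = word_length G S (inv g \<otimes> h)"
        "word_for G S ws (inv g \<otimes> h)"
      using G.word_length_attained[OF gen] by blast
    have "d x (\<phi> (inv g \<otimes> h) x) \<le> L * length ws"
      using dist_orbit_word_le[OF S(2) x le ws(2)] .
    then show "d (\<phi> g x) (\<phi> h x) \<le> L * word_metric G S g h"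
      using gh ws(1) by (simp add: dist_orbit x word_metric_def)
  qed
qed

text \<open>If \<open>g\<close> moves the base point into \<open>U\<close>, then left translation by \<open>inv g\<close> carries everything
  over \<open>U\<close> isometrically into the coarse stabilizer whose radius bounds the diameter of \<open>U\<close>.\<close>

lemma uniform_asdim_le_orbit_fibres:
  assumes x: "x \<in> X" and W: "asdim_le (coarse_stabilizer R x) (word_metric G S) n"
  shows "uniform_asdim_le
    {carrier G \<inter> (\<lambda>g. \<phi> g x) -` U | U. U \<subseteq> X \<and> set_diameter d U \<le> ereal R} (word_metric G S) n"
proof (rule uniform_asdim_le_isometric[OF W], clarify)
  fix U assume U: "U \<subseteq> X" "set_diameter d U \<le> ereal R"
  define A where "A = carrier G \<inter> (\<lambda>g. \<phi> g x) -` U"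
  show "\<exists>t. t ` A \<subseteq> coarse_stabilizer R x \<and>
      (\<forall>a\<in>A. \<forall>b\<in>A. word_metric G S (t a) (t b) = word_metric G S a b)"
  proof (cases "A = {}")
    case False
    then obtain g where g: "g \<in> carrier G" "\<phi> g x \<in> U"
      by (auto simp: A_def)
    have "inv g \<otimes> h \<in> coarse_stabilizer R x" if "h \<in> A" for h
    proof -
      have h: "h \<in> carrier G" "\<phi> h x \<in> U"
        using that by (auto simp: A_def)
      then have "d x (\<phi> (inv g \<otimes> h) x) \<le> R"
        using U(2) g x by (simp add: set_diameter_le_iff flip: dist_orbit)
      then show ?thesis
        using g h x by (simp add: coarse_stabilizer_def act_closed)
    qed
    moreover have "word_metric G S (inv g \<otimes> a) (inv g \<otimes> b) = word_metric G S a b"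
      if "a \<in> A" "b \<in> A" for a b
      using that g by (intro G.word_metric_left_invariant) (auto simp: A_def)
    ultimately show ?thesis
      by (intro exI[of _ "\<lambda>h. inv g \<otimes> h"]) blast
  qed simp
qed

end

text \<open>Sets of diameter at most \<open>R\<close> are treated with the radius \<open>max R 1\<close>, because the
  hypothesis on coarse stabilizers speaks of positive radii.\<close>

theorem theorem2:
  fixes G :: "('a, 'g) monoid_scheme"
    and S :: "'a set"
    and X :: "'x set"
    and d :: "'x \<Rightarrow> 'x \<Rightarrow> real"
    and \<phi> :: "'a \<Rightarrow> 'x \<Rightarrow> 'x"
    and x\<^sub>0 :: 'x
    and k n :: nat
  assumes "finite_generating_set G S"
    and "isometric_action G X \<phi> d"
    and "x\<^sub>0 \<in> X"
    and "asdim_le X d k"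
    and "\<And>R. R > 0 \<Longrightarrow>
           asdim_le (isometric_action.coarse_stabilizer G X \<phi> d R x\<^sub>0) (word_metric G S) n"
  shows "asdim_le (carrier G) (word_metric G S) ((n + 1) * (k + 1) - 1)"
proof -
  interpret isometric_action G X \<phi> d by fact
  obtain L where L: "L > 0" "\<And>g h. \<lbrakk>g \<in> carrier G; h \<in> carrier G\<rbrakk> \<Longrightarrow>
      d (\<phi> g x\<^sub>0) (\<phi> h x\<^sub>0) \<le> L * word_metric G S g h"
    using orbit_map_lipschitz[OF assms(1,3)] by blast
  show ?thesis
  proof (rule asdim_le_of_lipschitz_fibres[where f = "\<lambda>g. \<phi> g x\<^sub>0", OF _ L assms(4)])
    show "(\<lambda>g. \<phi> g x\<^sub>0) ` carrier G \<subseteq> X"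
      using act_closed assms(3) by blast
    fix R :: real
    have "uniform_asdim_le {carrier G \<inter> (\<lambda>g. \<phi> g x\<^sub>0) -` U | U.
        U \<subseteq> X \<and> set_diameter d U \<le> ereal (max R 1)} (word_metric G S) n"
      by (intro uniform_asdim_le_orbit_fibres assms) simp
    moreover have "ereal R \<le> ereal (max R 1)" by simp
    then have "{carrier G \<inter> (\<lambda>g. \<phi> g x\<^sub>0) -` U | U. U \<subseteq> X \<and> set_diameter d U \<le> ereal R} \<subseteq>
        {carrier G \<inter> (\<lambda>g. \<phi> g x\<^sub>0) -` U | U. U \<subseteq> X \<and> set_diameter d U \<le> ereal (max R 1)}"
      using order_trans by blast
    ultimately show "uniform_asdim_le {carrier G \<inter> (\<lambda>g. \<phi> g x\<^sub>0) -` U | U.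
        U \<subseteq> X \<and> set_diameter d U \<le> ereal R} (word_metric G S) n"
      unfolding uniform_asdim_le_def by (meson subsetD)
  qed
qed

end
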